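(* Let $\mathcal{A}$ and $\mathcal{B}$ be $C^{*}$-algebras, let $\Xi$ be a Hilbert $\mathcal{A}$-module and $\nabla$ a Hilbert $\mathcal{B}$-module. Let $f:\Xi \rightarrow \nabla$ be a mapping for which there exists a function $\varphi:\Xi^{3}\rightarrow[0,\infty)$ such that $$\| f(\mu x+y)-\mu f(x)-f(y)\| \leq \varphi(x,y,0),$$ $$\| f(\langle x,y\rangle z)-\langle f(x),f(y)\rangle f(z)\| \leq \varphi(x,y,z),$$ $$\| f(\langle x,y\rangle^{*} z)-\langle f(x),f(y)\rangle^{*} f(z)\| \leq \varphi(x,y,z)$$ for all $x,y,z\in\Xi$ and all $\mu\in\mathbb{T}$. If there exists $0\leq L<1$ such that $\varphi(x,y,z)\leq \frac{L}{8}\varphi(2x,2y,2z)$ for all $x,y,z\in\Xi$, then there exists a unique Hilbert $C^{*}$-module $\ast$-homomorphism $H:\Xi\rightarrow\nabla$ such that $$\|f(x)-H(x)\|\leq \frac{L}{8-8L}\varphi(x,x,0)$$ for all $x\in\Xi$.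
   Context: $\mathbb{T}=\{z\in\mathbb{C}:|z|=1\}$. For a $C^{*}$-algebra $\mathcal{A}$, a (left) Hilbert $\mathcal{A}$-module is a complex linear space $\Xi$ with a compatible left $\mathcal{A}$-module action ($\lambda(ax)=(\lambda a)x=a(\lambda x)$) and a map $\langle\cdot,\cdot\rangle:\Xi\times\Xi\to\mathcal{A}$ that is linear in the first variable, satisfies $\langle ax,y\rangle=a\langle x,y\rangle$, $\langle x,y\rangle^{*}=\langle y,x\rangle$, $\langle x,x\rangle\geq 0$ with equality iff $x=0$, and such that $\Xi$ is complete in the norm $\|x\|=\|\langle x,x\rangle\|^{1/2}$. For a Hilbert $\mathcal{A}$-module $\Xi$ and a Hilbert $\mathcal{B}$-module $\nabla$, a Hilbert $C^{*}$-module homomorphism is a $\mathbb{C}$-linear map $H:\Xi\to\nabla$ with $H(\langle x,y\rangle z)=\langle H(x),H(y)\rangle H(z)$ for all $x,y,z\in\Xi$; it is a Hilbert $C^{*}$-module $\ast$-homomorphism if moreover $H(\langle x,y\rangle^{*} z)=\langle H(x),H(y)\rangle^{*} H(z)$ for all $x,y,z\in\Xi$. *)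

theory Defs
  imports "HOL-Analysis.Analysis"
begin

text \<open>Isabelle/HOL has no class of complex vector spaces, so complex scalar
multiplication and the involution are explicit parameters.  A C*-algebra is a
real Banach algebra (type class) with a complex scalar multiplication
compatible with the real one, an involution, and the C*-identity.\<close>

definition cstar_algebra :: "(complex \<Rightarrow> 'a::{real_normed_algebra,banach} \<Rightarrow> 'a) \<Rightarrow> ('a \<Rightarrow> 'a) \<Rightarrow> bool" where
  "cstar_algebra sc st \<longleftrightarrow>
     (\<forall>c a b. sc c (a + b) = sc c a + sc c b) \<and>
     (\<forall>c d a. sc (c + d) a = sc c a + sc d a) \<and>
     (\<forall>c d a. sc (c * d) a = sc c (sc d a)) \<and>
     (\<forall>r a. sc (complex_of_real r) a = r *\<^sub>R a) \<and>
     (\<forall>c a b. sc c (a * b) = sc c a * b) \<and>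
     (\<forall>c a b. sc c (a * b) = a * sc c b) \<and>
     (\<forall>c a. norm (sc c a) = cmod c * norm a) \<and>
     (\<forall>a b. st (a + b) = st a + st b) \<and>
     (\<forall>c a. st (sc c a) = sc (cnj c) (st a)) \<and>
     (\<forall>a b. st (a * b) = st b * st a) \<and>
     (\<forall>a. st (st a) = a) \<and>
     (\<forall>a. norm (st a * a) = (norm a)\<^sup>2)"

definition cstar_nonneg :: "('a::{real_normed_algebra,banach} \<Rightarrow> 'a) \<Rightarrow> 'a \<Rightarrow> bool" where
  "cstar_nonneg st a \<longleftrightarrow> (\<exists>b. a = st b * b)"

definition hnorm :: "('x \<Rightarrow> 'x \<Rightarrow> 'a::real_normed_vector) \<Rightarrow> 'x \<Rightarrow> real" where
  "hnorm ip x = sqrt (norm (ip x x))"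

definition hilbert_module ::
  "(complex \<Rightarrow> 'a::{real_normed_algebra,banach} \<Rightarrow> 'a) \<Rightarrow> ('a \<Rightarrow> 'a) \<Rightarrow>
   (complex \<Rightarrow> 'x::ab_group_add \<Rightarrow> 'x) \<Rightarrow> ('a \<Rightarrow> 'x \<Rightarrow> 'x) \<Rightarrow> ('x \<Rightarrow> 'x \<Rightarrow> 'a) \<Rightarrow> bool" where
  "hilbert_module sA stA sX act ip \<longleftrightarrow>
     \<comment> \<open>complex vector space\<close>
     (\<forall>c x y. sX c (x + y) = sX c x + sX c y) \<and>
     (\<forall>c d x. sX (c + d) x = sX c x + sX d x) \<and>
     (\<forall>c d x. sX (c * d) x = sX c (sX d x)) \<and>
     (\<forall>x. sX 1 x = x) \<and>
     \<comment> \<open>compatible left module action\<close>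
     (\<forall>a x y. act a (x + y) = act a x + act a y) \<and>
     (\<forall>a b x. act (a + b) x = act a x + act b x) \<and>
     (\<forall>a b x. act (a * b) x = act a (act b x)) \<and>
     (\<forall>c a x. sX c (act a x) = act (sA c a) x) \<and>
     (\<forall>c a x. act (sA c a) x = act a (sX c x)) \<and>
     \<comment> \<open>inner product\<close>
     (\<forall>x y z. ip (x + y) z = ip x z + ip y z) \<and>
     (\<forall>c x y. ip (sX c x) y = sA c (ip x y)) \<and>
     (\<forall>a x y. ip (act a x) y = a * ip x y) \<and>
     (\<forall>x y. stA (ip x y) = ip y x) \<and>
     (\<forall>x. cstar_nonneg stA (ip x x)) \<and>
     (\<forall>x. ip x x = 0 \<longleftrightarrow> x = 0) \<and>
     \<comment> \<open>completeness w.r.t. the norm hnorm ip\<close>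
     (\<forall>X::nat \<Rightarrow> 'x. (\<forall>e>0. \<exists>N. \<forall>m\<ge>N. \<forall>n\<ge>N. hnorm ip (X m - X n) < e) \<longrightarrow>
        (\<exists>l. (\<lambda>n. hnorm ip (X n - l)) \<longlonglongrightarrow> 0))"

definition hm_hom ::
  "(complex \<Rightarrow> 'x::ab_group_add \<Rightarrow> 'x) \<Rightarrow> ('a \<Rightarrow> 'x \<Rightarrow> 'x) \<Rightarrow> ('x \<Rightarrow> 'x \<Rightarrow> 'a) \<Rightarrow>
   (complex \<Rightarrow> 'y::ab_group_add \<Rightarrow> 'y) \<Rightarrow> ('b \<Rightarrow> 'y \<Rightarrow> 'y) \<Rightarrow> ('y \<Rightarrow> 'y \<Rightarrow> 'b) \<Rightarrow>
   ('x \<Rightarrow> 'y) \<Rightarrow> bool" where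
  "hm_hom sX actX ipX sY actY ipY H \<longleftrightarrow>
     (\<forall>x y. H (x + y) = H x + H y) \<and>
     (\<forall>c x. H (sX c x) = sY c (H x)) \<and>
     (\<forall>x y z. H (actX (ipX x y) z) = actY (ipY (H x) (H y)) (H z))"

definition hm_star_hom ::
  "('a \<Rightarrow> 'a) \<Rightarrow> ('b \<Rightarrow> 'b) \<Rightarrow>
   (complex \<Rightarrow> 'x::ab_group_add \<Rightarrow> 'x) \<Rightarrow> ('a \<Rightarrow> 'x \<Rightarrow> 'x) \<Rightarrow> ('x \<Rightarrow> 'x \<Rightarrow> 'a) \<Rightarrow>
   (complex \<Rightarrow> 'y::ab_group_add \<Rightarrow> 'y) \<Rightarrow> ('b \<Rightarrow> 'y \<Rightarrow> 'y) \<Rightarrow> ('y \<Rightarrow> 'y \<Rightarrow> 'b) \<Rightarrow>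
   ('x \<Rightarrow> 'y) \<Rightarrow> bool" where
  "hm_star_hom stA stB sX actX ipX sY actY ipY H \<longleftrightarrow>
     hm_hom sX actX ipX sY actY ipY H \<and>
     (\<forall>x y z. H (actX (stA (ipX x y)) z) = actY (stB (ipY (H x) (H y))) (H z))"

end

theory Submission
  imports Defs
begin

text \<open>The homomorphism is the Hyers limit \<open>H x = lim 2\<^sup>n f (x / 2\<^sup>n)\<close>; the three functional
  inequalities, rescaled by \<open>2\<^sup>n\<close> and \<open>8\<^sup>n\<close>, become identities in the limit because
  \<open>\<phi>\<close> decays like \<open>(L / 8)\<^sup>n\<close>.  The identity involving \<open>\<langle>x, y\<rangle>\<^sup>*\<close> is the one for
  \<open>\<langle>y, x\<rangle>\<close>.

  The analytic input is the triangle inequality for \<open>\<parallel>\<langle>x, x\<rangle>\<parallel>\<^sup>1\<^sup>/\<^sup>2\<close>.  It reduces to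
  \<open>\<parallel>a\<^sup>* a\<parallel> \<le> \<parallel>a\<^sup>* a + b\<^sup>* b\<parallel>\<close> in a C*-algebra, that is, to the positivity of \<open>a\<^sup>* a\<close>.
  This is proved without spectral theory: a self-adjoint \<open>h\<close> is called positive if
  \<open>\<parallel>t - h\<parallel> \<le> t\<close> for some \<open>t > 0\<close>, positive elements have square roots, and norm bounds come
  from writing a self-adjoint element as the real part of a multiple of a unitary.\<close>

section \<open>Positive elements\<close>

text \<open>The increments of \<open>\<beta>\<close> telescope and are therefore summable, so those
  of \<open>b\<close> are summable by comparison.\<close>

lemma convergent_if_increments_dominated:
  fixes b :: "nat \<Rightarrow> 'a::banach" and \<beta> :: "nat \<Rightarrow> real"
  assumes step: "\<And>n. norm (b (Suc n) - b n) \<le> \<beta> (Suc n) - \<beta> n" and "convergent \<beta>"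
  shows "convergent b"
proof -
  have "summable (\<lambda>n. \<beta> (Suc n) - \<beta> n)"
    using \<open>convergent \<beta>\<close> telescope_summable by (auto simp: convergent_def)
  then have "summable (\<lambda>n. b (Suc n) - b n)"
    using step by (rule summable_comparison_test')
  then have "convergent (\<lambda>n. b n - b 0)"
    by (simp add: summable_iff_convergent sum_lessThan_telescope)
  then show ?thesis
    using convergent_diff_const_right_iff by blast
qed

text \<open>\<open>adj\<close> is a relation because an operator on a Banach space need not have an
  adjoint. \<open>J\<close> stands for multiplication by the imaginary unit; it has to commute only
  with elements that have an adjoint, since other operators may be merely real-linear. The bound
  \<open>norm e \<le> 1\<close> admits the zero algebra.\<close>

locale adjoint_algebra =
  fixes adj :: "'u::{real_normed_algebra,banach} \<Rightarrow> 'u \<Rightarrow> bool" and e J :: 'u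
  assumes adj_sym: "adj x x' \<Longrightarrow> adj x' x"
    and adj_add: "adj x x' \<Longrightarrow> adj y y' \<Longrightarrow> adj (x + y) (x' + y')"
    and adj_scaleR: "adj x x' \<Longrightarrow> adj (r *\<^sub>R x) (r *\<^sub>R x')"
    and adj_mult: "adj x x' \<Longrightarrow> adj y y' \<Longrightarrow> adj (x * y) (y' * x')"
    and unit_left [simp]: "e * x = x"
    and unit_right [simp]: "x * e = x"
    and adj_unit: "adj e e"
    and closed_selfadjoint: "closed {x. adj x x}"
    and norm_adj: "adj x x' \<Longrightarrow> (norm x)\<^sup>2 \<le> norm (x' * x)"
    and norm_unit_le: "norm e \<le> 1"
    and J_square: "J * J = - e"
    and adj_J: "adj J (- J)"
    and J_commute: "adj x x' \<Longrightarrow> J * x = x * J"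
begin

section \<open>Elementary rules for adjoints\<close>

lemma adj_minus: "adj x x' \<Longrightarrow> adj (- x) (- x')"
  using adj_scaleR[of x x' "-1"] by simp

lemma adj_diff: "adj x x' \<Longrightarrow> adj y y' \<Longrightarrow> adj (x - y) (x' - y')"
  using adj_add[of x x' "- y" "- y'"] adj_minus by simp

lemma adj_zero: "adj 0 0"
  using adj_scaleR[OF adj_unit, of 0] by simp

lemma norm_adj_eq:
  assumes "adj x x'"
  shows "norm x' = norm x"
proof -
  have "norm x \<le> norm x'" if "adj x x'" for x x'
  proof (cases "norm x = 0")
    case False
    have "(norm x)\<^sup>2 \<le> norm x' * norm x"
      using norm_adj[OF that] norm_mult_ineq order_trans by blast
    with False show ?thesis
      by (simp add: power2_eq_square)
  qed simp
  then show ?thesis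
    using assms adj_sym by (meson order_antisym)
qed

text \<open>The iteration \<open>b \<mapsto> (a + b\<^sup>2) / 2\<close> has nonnegative coefficients, so its increments are
  dominated by those of the same iteration in \<open>\<real>\<close> started with \<open>a = 1\<close>; its limit solves
  \<open>(e - b)\<^sup>2 = e - a\<close>.\<close>

lemma sqrt_unit_minus:
  assumes a: "adj a a" "norm a \<le> 1"
  obtains s where "adj s s" "s * s = e - a" "norm (e - s) \<le> 1"
    "\<And>c. c * a = a * c \<Longrightarrow> c * s = s * c"
proof -
  define b where "b = rec_nat (0::'u) (\<lambda>_ b. (1/2) *\<^sub>R (a + b * b))"
  define \<beta> where "\<beta> = rec_nat (0::real) (\<lambda>_ b. (1/2) * (1 + b * b))"
  have b0: "b 0 = 0" and bS: "b (Suc n) = (1/2) *\<^sub>R (a + b n * b n)" for n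
    by (auto simp: b_def)
  have \<beta>0: "\<beta> 0 = 0" and \<beta>S: "\<beta> (Suc n) = (1/2) * (1 + \<beta> n * \<beta> n)" for n
    by (auto simp: \<beta>_def)
  have \<beta>: "0 \<le> \<beta> n \<and> \<beta> n \<le> 1" for n
  proof (induction n)
    case (Suc n)
    have "\<beta> n * \<beta> n \<le> 1 * 1" using Suc by (intro mult_mono) auto
    then show ?case using Suc by (auto simp: \<beta>S)
  qed (simp add: \<beta>0)
  have inc: "\<beta> n \<le> \<beta> (Suc n)" for n
    using zero_le_square[of "1 - \<beta> n"] by (simp add: \<beta>S algebra_simps)
  have "convergent \<beta>"
    using \<beta> inc by (intro Bseq_monoseq_convergent) (auto simp: Bseq_def monoseq_Suc intro!: exI[of _ 1])
  have nb: "norm (b n) \<le> \<beta> n" for n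
  proof (induction n)
    case (Suc n)
    have "norm (b n * b n) \<le> \<beta> n * \<beta> n"
      using norm_mult_ineq[of "b n" "b n"] mult_mono[OF Suc Suc] \<beta>[of n] by force
    then have "norm (a + b n * b n) \<le> 1 + \<beta> n * \<beta> n"
      using a norm_triangle_ineq[of a "b n * b n"] by linarith
    then show ?case by (simp add: bS \<beta>S)
  qed (simp add: b0 \<beta>0)
  have ba: "c * b n = b n * c" if "c * a = a * c" for c n
  proof (induction n)
    case (Suc n)
    have "c * (b n * b n) = (b n * b n) * c" using Suc by (metis mult.assoc)
    then show ?case using that by (simp add: bS algebra_simps)
  qed (simp add: b0)
  have bb: "b m * b n = b n * b m" for m n
    using ba by metis
  have step: "norm (b (Suc n) - b n) \<le> \<beta> (Suc n) - \<beta> n" for n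
  proof (induction n)
    case 0
    then show ?case using a by (simp add: b0 \<beta>0 bS \<beta>S)
  next
    case (Suc n)
    have "b (Suc (Suc n)) - b (Suc n)
        = (1/2) *\<^sub>R (a + b (Suc n) * b (Suc n)) - (1/2) *\<^sub>R (a + b n * b n)"
      by (rule arg_cong2[of _ _ _ _ minus]) (rule bS)+
    \<comment> \<open>A difference of squares factors because the iterates commute.\<close>
    also have "\<dots> = (1/2) *\<^sub>R ((b (Suc n) - b n) * (b (Suc n) + b n))"
      using bb[of "Suc n" n] by (simp add: algebra_simps)
    also have "norm \<dots> \<le> (1/2) * ((\<beta> (Suc n) - \<beta> n) * (\<beta> (Suc n) + \<beta> n))"
    proof -
      have "norm (b (Suc n) + b n) \<le> \<beta> (Suc n) + \<beta> n"
        using nb norm_triangle_mono by blast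
      then have "norm (b (Suc n) - b n) * norm (b (Suc n) + b n)
          \<le> (\<beta> (Suc n) - \<beta> n) * (\<beta> (Suc n) + \<beta> n)"
        using Suc inc[of n] by (intro mult_mono) auto
      then show ?thesis
        using norm_mult_ineq[of "b (Suc n) - b n" "b (Suc n) + b n"] by simp
    qed
    also have "\<dots> = \<beta> (Suc (Suc n)) - \<beta> (Suc n)"
      using \<beta>S[of "Suc n"] \<beta>S[of n] by (simp add: algebra_simps)
    finally show ?case .
  qed
  obtain l where l: "b \<longlonglongrightarrow> l"
    using convergent_if_increments_dominated[OF step \<open>convergent \<beta>\<close>] by (auto simp: convergent_def)
  have "(\<lambda>n. b (Suc n)) \<longlonglongrightarrow> (1/2) *\<^sub>R (a + l * l)"
    unfolding bS by (intro tendsto_intros l)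
  then have leq: "l = (1/2) *\<^sub>R (a + l * l)"
    using LIMSEQ_unique LIMSEQ_Suc[OF l] by blast
  have "adj (b n) (b n)" for n
    by (induction n) (auto simp: b0 bS intro!: adj_zero adj_scaleR adj_add a adj_mult)
  then have "adj l l"
    using closed_sequentially[OF closed_selfadjoint, of b l] l by auto
  have "2 *\<^sub>R l = a + l * l"
    by (subst leq) simp
  then have "l + l = a + l * l"
    by (simp add: scaleR_2)
  then have sq: "(e - l) * (e - l) = e - a"
    by (simp add: algebra_simps)
  have "norm (b n) \<le> 1" for n
    using nb[of n] \<beta>[of n] by linarith
  then have "norm l \<le> 1"
    using l by (intro LIMSEQ_le_const2[OF tendsto_norm[OF l]]) auto
  have comm: "c * l = l * c" if "c * a = a * c" for c
  proof -
    have "(\<lambda>n. c * b n) \<longlonglongrightarrow> c * l" "(\<lambda>n. b n * c) \<longlonglongrightarrow> l * c"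
      by (intro tendsto_intros l)+
    then show ?thesis
      using ba[OF that] LIMSEQ_unique by auto
  qed
  show thesis
  proof
    show "adj (e - l) (e - l)" using \<open>adj l l\<close> adj_unit adj_diff by blast
    show "norm (e - (e - l)) \<le> 1" using \<open>norm l \<le> 1\<close> by simp
    show "c * (e - l) = (e - l) * c" if "c * a = a * c" for c
      using comm[OF that] by (simp add: algebra_simps)
  qed (rule sq)
qed

text \<open>In spectral terms the norm condition puts the spectrum of \<open>h\<close> in the
  interval [0, 2t]. Leaving \<open>t\<close> free makes closure under sums immediate, since the
  witnesses add up.\<close>

definition pos :: "'u \<Rightarrow> bool" where
  "pos h \<longleftrightarrow> adj h h \<and> (\<exists>t>0. norm (t *\<^sub>R e - h) \<le> t)"

section \<open>The cone of positive elements, square roots and norm bounds\<close>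

lemma posI: "adj h h \<Longrightarrow> 0 < t \<Longrightarrow> norm (t *\<^sub>R e - h) \<le> t \<Longrightarrow> pos h"
  unfolding pos_def by blast

lemma pos_adj: "pos h \<Longrightarrow> adj h h"
  unfolding pos_def by blast

lemma pos_add:
  assumes "pos h" "pos k"
  shows "pos (h + k)"
proof -
  obtain s t where "0 < s" "norm (s *\<^sub>R e - h) \<le> s" "0 < t" "norm (t *\<^sub>R e - k) \<le> t"
    using assms unfolding pos_def by blast
  moreover have "(s + t) *\<^sub>R e - (h + k) = (s *\<^sub>R e - h) + (t *\<^sub>R e - k)"
    by (simp add: algebra_simps)
  ultimately have "norm ((s + t) *\<^sub>R e - (h + k)) \<le> s + t"
    using norm_triangle_mono by metis
  then show ?thesis
    using \<open>0 < s\<close> \<open>0 < t\<close> pos_adj adj_add assms by (intro posI[of _ "s + t"]) auto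
qed

lemma pos_scaleR:
  assumes "pos h" "0 < r"
  shows "pos (r *\<^sub>R h)"
proof -
  obtain t where "0 < t" "norm (t *\<^sub>R e - h) \<le> t"
    using assms unfolding pos_def by blast
  moreover have "norm ((r * t) *\<^sub>R e - r *\<^sub>R h) = r * norm (t *\<^sub>R e - h)"
    using assms(2) by (simp flip: scaleR_scaleR scaleR_diff_right)
  ultimately show ?thesis
    using assms pos_adj adj_scaleR by (intro posI[of _ "r * t"]) auto
qed

lemma pos_const:
  assumes "0 \<le> t"
  shows "pos (t *\<^sub>R e)"
proof (cases "t = 0")
  case True
  show ?thesis
    using True norm_unit_le adj_zero by (intro posI[of _ 1]) auto
next
  case False
  then show ?thesis
    using assms adj_unit adj_scaleR by (intro posI[of _ t]) auto
qed

text \<open>For \<open>t > 0\<close> the witness is \<open>t\<close> itself, because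
  \<open>t e - (t e - h) = h\<close>. For \<open>t = 0\<close> the element is zero.\<close>

lemma pos_const_minus:
  assumes "adj h h" "norm h \<le> t"
  shows "pos (t *\<^sub>R e - h)"
proof (cases "t = 0")
  case True
  then show ?thesis using assms pos_const[of 0] by simp
next
  case False
  then have "0 < t" using assms(2) norm_ge_zero[of h] by linarith
  then show ?thesis
    using assms adj_unit adj_scaleR adj_diff by (intro posI[of _ t]) auto
qed

text \<open>After division by \<open>t\<close>, the element \<open>a = e - h / t\<close> has norm at
  most 1, so \<open>e - a\<close> has a root \<open>s\<close>. That root is positive with witness 1,
  by the bound on \<open>norm (e - s)\<close>.\<close>

lemma pos_sqrt:
  assumes "pos h"
  obtains s where "pos s" "s * s = h" "\<And>c. c * h = h * c \<Longrightarrow> c * s = s * c"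
proof -
  obtain t where t: "0 < t" "norm (t *\<^sub>R e - h) \<le> t"
    using assms unfolding pos_def by blast
  define a where "a = e - (1/t) *\<^sub>R h"
  have "a = (1/t) *\<^sub>R (t *\<^sub>R e - h)"
    using t by (simp add: a_def algebra_simps)
  then have "norm a \<le> 1" using t by simp
  moreover have "adj a a"
    unfolding a_def using assms pos_adj adj_diff adj_unit adj_scaleR by blast
  ultimately obtain s where s: "adj s s" "s * s = e - a" "norm (e - s) \<le> 1"
    and comm: "\<And>c. c * a = a * c \<Longrightarrow> c * s = s * c"
    using sqrt_unit_minus by metis
  show thesis
  proof
    show "pos (sqrt t *\<^sub>R s)"
      using s t by (intro pos_scaleR posI[of _ 1]) auto
    show "(sqrt t *\<^sub>R s) * (sqrt t *\<^sub>R s) = h"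
      using s(2) t by (simp add: a_def)
    show "c * (sqrt t *\<^sub>R s) = (sqrt t *\<^sub>R s) * c" if "c * h = h * c" for c
      using comm[of c] that by (simp add: a_def algebra_simps)
  qed
qed

text \<open>\<open>u = k + i m\<close> is \<open>t\<close> times a unitary, and \<open>2 k = u + u\<^sup>*\<close>.\<close>

lemma norm_le_if_sum_squares:
  assumes k: "adj k k" and m: "adj m m" and km: "k * m = m * k"
    and sq: "k * k + m * m = t\<^sup>2 *\<^sub>R e" and "0 \<le> t"
  shows "norm k \<le> t"
proof -
  define u where "u = k + J * m"
  define u' where "u' = k - J * m"
  have Jk: "J * k = k * J" and Jm: "J * m = m * J"
    using J_commute k m by auto
  have "adj (J * m) (m * - J)"
    using adj_mult[OF adj_J m] .
  then have "adj u u'"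
    using adj_add[OF k, of "J * m" "m * - J"] by (simp add: u_def u'_def Jm)
  have "(J * m) * (J * m) = - (m * m)"
    by (metis J_square Jm mult.assoc unit_right mult_minus_right)
  moreover have "k * (J * m) = (J * m) * k"
    by (metis Jk km mult.assoc)
  ultimately have "u' * u = t\<^sup>2 *\<^sub>R e"
    by (simp add: u_def u'_def algebra_simps flip: sq)
  then have "(norm u)\<^sup>2 \<le> t\<^sup>2 * norm e"
    using norm_adj[OF \<open>adj u u'\<close>] by simp
  also have "\<dots> \<le> t\<^sup>2"
    using norm_unit_le by (simp add: mult_left_le)
  finally have "norm u \<le> t"
    using \<open>0 \<le> t\<close> by (rule power2_le_imp_le)
  moreover have "norm u' = norm u"
    using \<open>adj u u'\<close> by (rule norm_adj_eq)
  moreover have "2 *\<^sub>R k = u + u'"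
    by (simp add: u_def u'_def scaleR_2)
  then have "2 * norm k \<le> norm u + norm u'"
    by (metis norm_scaleR norm_triangle_ineq abs_numeral)
  ultimately show ?thesis by linarith
qed

text \<open>Normalize \<open>k\<close> to \<open>l\<close> of norm 1 and let \<open>m\<close> be a
  root of \<open>e - l * l\<close>. Since \<open>l\<close> and \<open>m\<close> commute and their
  squares add up to \<open>e\<close>, also \<open>norm m \<le> 1\<close>; hence
  \<open>norm (e - l * l) \<le> 1\<close>, which is positivity of \<open>l * l\<close> with witness
  1.\<close>

lemma pos_square:
  assumes "adj k k"
  shows "pos (k * k)"
proof (cases "k = 0")
  case True
  then show ?thesis using pos_const[of 0] by simp
next
  case False
  define l where "l = (1 / norm k) *\<^sub>R k"
  have nl: "norm l = 1" using False by (simp add: l_def)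
  have l: "adj l l" unfolding l_def using assms by (rule adj_scaleR)
  have "norm (l * l) \<le> 1"
    using norm_mult_ineq[of l l] nl by simp
  then obtain m where m: "adj m m" "m * m = e - l * l" "\<And>c. c * (l * l) = l * l * c \<Longrightarrow> c * m = m * c"
    using sqrt_unit_minus adj_mult[OF l l] by metis
  have "norm m \<le> 1"
    using m(1,2) m(3)[of l] l by (intro norm_le_if_sum_squares[of m l]) (auto simp: mult.assoc)
  then have "norm (m * m) \<le> 1 * 1"
    using norm_mult_ineq[of m m] mult_mono[of "norm m" 1 "norm m" 1] by simp
  then have "pos (l * l)"
    using m(2) adj_mult[OF l l] by (intro posI[of _ 1]) auto
  then have "pos ((norm k)\<^sup>2 *\<^sub>R (l * l))"
    using False by (intro pos_scaleR) auto
  also have "(norm k)\<^sup>2 *\<^sub>R (l * l) = k * k"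
    using False by (simp add: l_def power2_eq_square)
  finally show ?thesis .
qed

text \<open>The roots \<open>k\<close> of \<open>h\<close> and \<open>m\<close> of
  \<open>t e - h\<close> commute and their squares add up to \<open>t e\<close>, so
  \<open>norm k\<close> is at most the square root of \<open>t\<close>.\<close>

lemma pos_norm_le:
  assumes "pos h" "pos (t *\<^sub>R e - h)" "0 \<le> t"
  shows "norm h \<le> t"
proof -
  obtain k where k: "pos k" "k * k = h" "\<And>c. c * h = h * c \<Longrightarrow> c * k = k * c"
    using pos_sqrt[OF assms(1)] by metis
  obtain m where m: "pos m" "m * m = t *\<^sub>R e - h"
    "\<And>c. c * (t *\<^sub>R e - h) = (t *\<^sub>R e - h) * c \<Longrightarrow> c * m = m * c"
    using pos_sqrt[OF assms(2)] by metis
  have "k * h = h * k"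
    using k(2) by (metis mult.assoc)
  then have "k * m = m * k"
    by (intro m(3)) (simp add: algebra_simps)
  then have "norm k \<le> sqrt t"
    using k(1,2) m(1,2) assms(3) by (intro norm_le_if_sum_squares[of k m]) (auto simp: pos_adj)
  then have "norm k * norm k \<le> sqrt t * sqrt t"
    using assms(3) by (intro mult_mono) auto
  then show ?thesis
    using norm_mult_ineq[of k k] k(2) assms(3) by auto
qed

text \<open>With N the norm of \<open>h + k\<close>, the element N e - h is the sum of the positive
  elements N e - (h + k) and \<open>k\<close>.\<close>

lemma norm_pos_mono:
  assumes "pos h" "pos k"
  shows "norm h \<le> norm (h + k)"
proof -
  have "pos ((norm (h + k) *\<^sub>R e - (h + k)) + k)"
    using assms by (intro pos_add pos_const_minus pos_adj) auto
  then show ?thesis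
    using assms by (intro pos_norm_le) auto
qed

text \<open>Positivity of N e - (h + s e) is positivity of (N - s) e - h, which bounds
  \<open>norm h\<close> once N - s is known to be nonnegative. That sign uses
  \<open>norm e \<ge> 1\<close>, which follows from \<open>h \<noteq> 0\<close>.\<close>

lemma norm_pos_add_const:
  assumes "pos h" "h \<noteq> 0" "0 \<le> s"
  shows "norm h + s \<le> norm (h + s *\<^sub>R e)"
proof -
  let ?N = "norm (h + s *\<^sub>R e)"
  have "norm h * 1 \<le> norm h * norm e"
    using norm_mult_ineq[of h e] by simp
  then have "1 \<le> norm e"
    using assms(2) by (simp del: mult_1_right)
  then have "s * 1 \<le> s * norm e"
    using assms(3) by (intro mult_left_mono)
  also have "\<dots> = norm (s *\<^sub>R e)"
    using assms(3) by simp
  also have "\<dots> \<le> ?N"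
    using norm_pos_mono[OF pos_const assms(1), of s] assms(3) by (simp add: add.commute)
  finally have "s \<le> ?N" by simp
  moreover have "pos (?N *\<^sub>R e - (h + s *\<^sub>R e))"
    using assms by (intro pos_const_minus pos_adj pos_add pos_const) auto
  then have "pos ((?N - s) *\<^sub>R e - h)"
    by (simp add: algebra_simps)
  ultimately have "norm h \<le> ?N - s"
    using assms(1) by (intro pos_norm_le) auto
  then show ?thesis by simp
qed

text \<open>This replaces the fact that \<open>y\<^sup>* y\<close> and \<open>y y\<^sup>*\<close> have the same nonzero spectrum: with
  \<open>t = \<parallel>q\<^sup>2\<parallel>\<close>, the element \<open>y\<^sup>* (t - y y\<^sup>*) y = - (t q\<^sup>2 + q\<^sup>4)\<close> has norm at most \<open>t\<^sup>2\<close> by the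
  left-hand side, but norm \<open>2 t\<^sup>2\<close> by the right-hand side.\<close>

lemma zero_if_adj_mult_nonpos:
  assumes y: "adj y y'" and q: "adj q q" and yq: "y' * y = - (q * q)" and p: "pos (y * y')"
  shows "y = 0"
proof (rule ccontr)
  assume "y \<noteq> 0"
  define h where "h = q * q"
  define t where "t = norm h"
  have h: "pos h" unfolding h_def using q by (rule pos_square)
  have yh: "y' * y = - h" using yq by (simp add: h_def)
  have ny: "(norm y)\<^sup>2 \<le> t"
    using norm_adj[OF y] by (simp add: yh t_def)
  have "0 < (norm y)\<^sup>2" using \<open>y \<noteq> 0\<close> by simp
  with ny have "0 < t" by linarith
  have ny': "norm y' = norm y" using y by (rule norm_adj_eq)
  have "norm (y * y') \<le> t"
    using norm_mult_ineq[of y y'] ny by (simp add: ny' power2_eq_square)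
  then have "pos (t *\<^sub>R e - y * y')"
    using p by (intro pos_const_minus pos_adj)
  then have "norm (t *\<^sub>R e - y * y') \<le> t"
    using p \<open>0 < t\<close> by (intro pos_norm_le) auto
  then have "norm y' * norm (t *\<^sub>R e - y * y') * norm y \<le> norm y * t * norm y"
    by (simp add: ny' mult_left_mono mult_right_mono)
  also have "\<dots> \<le> t * t"
    using mult_right_mono[OF ny, of t] \<open>0 < t\<close> by (simp add: power2_eq_square mult_ac)
  finally have "norm (y' * (t *\<^sub>R e - y * y') * y) \<le> t * t"
    by (meson norm_mult_ineq order_trans mult_right_mono norm_ge_zero)
  moreover have "y' * (t *\<^sub>R e - y * y') * y = - (t *\<^sub>R h + h * h)"
  proof -
    have "y' * (t *\<^sub>R e - y * y') * y = t *\<^sub>R (y' * y) - (y' * y) * (y' * y)"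
      by (simp add: algebra_simps)
    then show ?thesis by (simp add: yh)
  qed
  ultimately have 1: "norm (t *\<^sub>R h + h * h) \<le> t * t"
    by (simp only: norm_minus_cancel)
  \<comment> \<open>Complete the square: \<open>?g * ?g\<close> exceeds \<open>t h + h h\<close> by
    a quarter of t squared times \<open>e\<close>. As \<open>norm ?g\<close> is at least 3t/2, this
    gives 9/4 against 5/4 times t squared.\<close>
  let ?g = "h + (t/2) *\<^sub>R e"
  have g: "adj ?g ?g"
    using h pos_adj adj_add adj_unit adj_scaleR by blast
  have "?g * ?g = (t *\<^sub>R h + h * h) + (t * t / 4) *\<^sub>R e"
    by (simp add: algebra_simps flip: scaleR_add_left)
  then have "norm (?g * ?g) \<le> norm (t *\<^sub>R h + h * h) + norm ((t * t / 4) *\<^sub>R e)"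
    using norm_triangle_ineq by metis
  also have "norm ((t * t / 4) *\<^sub>R e) \<le> t * t / 4"
    using norm_unit_le \<open>0 < t\<close> by (simp add: mult_left_le)
  finally have "(norm ?g)\<^sup>2 \<le> 5/4 * (t * t)"
    using norm_adj[OF g] 1 by simp
  moreover have "3/2 * t \<le> norm ?g"
    using norm_pos_add_const[OF h, of "t/2"] \<open>0 < t\<close> by (auto simp: t_def)
  then have "(3/2 * t)\<^sup>2 \<le> (norm ?g)\<^sup>2"
    using \<open>0 < t\<close> by (intro power_mono) auto
  ultimately have "t * t \<le> 0"
    by (simp add: power2_eq_square)
  then show False
    using \<open>0 < t\<close> by (simp add: mult_le_0_iff)
qed

text \<open>Up to real factors, \<open>y + y'\<close> and \<open>J * (y - y')\<close> are the real
  and imaginary parts of \<open>y\<close>. Both are self-adjoint, and the mixed terms in the sum of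
  their squares cancel as needed.\<close>

lemma pos_adj_mult_add_mult_adj:
  assumes "adj y y'"
  shows "pos (y * y' + y' * y)"
proof -
  let ?a = "y + y'" and ?d = "y - y'"
  have a: "adj ?a ?a"
    using adj_add[OF assms adj_sym[OF assms]] by (simp add: add.commute)
  have d: "adj ?d (- ?d)"
    using adj_diff[OF assms adj_sym[OF assms]] by simp
  have Jd: "J * ?d = ?d * J" using d by (rule J_commute)
  have b: "adj (J * ?d) (J * ?d)"
    using adj_mult[OF adj_J d] unfolding Jd minus_mult_minus .
  have "(J * ?d) * (J * ?d) = J * (?d * J) * ?d"
    by (simp only: mult.assoc)
  also have "\<dots> = (J * J) * (?d * ?d)"
    by (simp only: Jd[symmetric] mult.assoc)
  finally have eq: "(J * ?d) * (J * ?d) = - (?d * ?d)"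
    by (simp add: J_square)
  have "?a * ?a + (J * ?d) * (J * ?d) = 2 *\<^sub>R (y * y' + y' * y)"
    unfolding eq by (simp add: algebra_simps scaleR_2)
  then have "y * y' + y' * y = (1/2) *\<^sub>R (?a * ?a + (J * ?d) * (J * ?d))"
    by simp
  then show ?thesis
    using pos_scaleR[OF pos_add[OF pos_square[OF a] pos_square[OF b]], of "1/2"] by simp
qed

text \<open>With \<open>h = x\<^sup>* x\<close>, \<open>w = \<bar>h\<bar>\<close> and \<open>y = x (w - h)\<close> one has \<open>y\<^sup>* y = - w (w - h)\<^sup>2 \<le> 0\<close>, which
  forces \<open>y = 0\<close> and hence \<open>h = w\<close>.\<close>

lemma pos_adj_mult:
  assumes x: "adj x x'"
  shows "pos (x' * x)"
proof -
  define h where "h = x' * x"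
  have h: "adj h h" unfolding h_def using adj_mult x adj_sym by blast
  obtain w where w: "pos w" "w * w = h * h" "\<And>c. c * (h * h) = h * h * c \<Longrightarrow> c * w = w * c"
    using pos_sqrt[OF pos_square[OF h]] by metis
  have hw: "h * w = w * h" by (rule w) (simp add: mult.assoc)
  obtain s where s: "pos s" "s * s = w" "\<And>c. c * w = w * c \<Longrightarrow> c * s = s * c"
    using pos_sqrt[OF w(1)] by metis
  define d where "d = w - h"
  have d: "adj d d" unfolding d_def using w h pos_adj adj_diff by blast
  have dw: "d * w = w * d" by (simp add: d_def hw algebra_simps)
  have ds: "d * s = s * d" using dw by (rule s)
  \<comment> \<open>This is (w + h)(w - h) = 0 for commuting \<open>w\<close> and \<open>h\<close>
    with equal squares.\<close>
  have hd: "h * d = - (w * d)" using w(2) hw by (simp add: d_def algebra_simps)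
  \<comment> \<open>The root \<open>s\<close> of \<open>w\<close> turns \<open>w * d * d\<close>
    into the square of a self-adjoint element.\<close>
  define q where "q = s * d"
  have q: "adj q q" unfolding q_def using adj_mult[OF pos_adj[OF s(1)] d] ds by simp
  define y where "y = x * d"
  define y' where "y' = d * x'"
  have y: "adj y y'" unfolding y_def y'_def using x d by (rule adj_mult)
  have "y' * y = d * (h * d)" by (simp add: y_def y'_def h_def mult.assoc)
  also have "\<dots> = - (q * q)"
    unfolding hd q_def s(2)[symmetric] mult_minus_right by (metis ds mult.assoc)
  finally have yq: "y' * y = - (q * q)" .
  \<comment> \<open>Adding \<open>q * q\<close> cancels \<open>y' * y\<close>, which leaves
    \<open>y * y'\<close> positive.\<close>
  have "pos (y * y' + y' * y + q * q)"
    using pos_adj_mult_add_mult_adj[OF y] pos_square[OF q] by (rule pos_add)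
  then have "pos (y * y')" by (simp add: yq)
  then have "y = 0" using zero_if_adj_mult_nonpos[OF y q yq] by simp
  have "h * d = x' * y" by (simp add: h_def y_def mult.assoc)
  then have "h * d = 0" using \<open>y = 0\<close> by simp
  moreover have "d * d = w * d - h * d"
    unfolding left_diff_distrib[symmetric] d_def ..
  ultimately have "d * d = 0" using hd by simp
  then have "d = 0" using norm_adj[OF d] by simp
  then have "h = w" by (simp add: d_def)
  then show ?thesis using w(1) by (simp add: h_def)
qed

theorem norm_adj_mult_le_sum:
  assumes "adj x x'" "adj y y'"
  shows "(norm x)\<^sup>2 \<le> norm (x' * x + y' * y)"
  using norm_adj[OF assms(1)] norm_pos_mono[OF pos_adj_mult pos_adj_mult, OF assms] by linarith

end

section \<open>The operator representation of a C*-algebra\<close>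

text \<open>The continuous linear endomorphisms of a Banach space, as a type of their own because
  \<open>blinfun\<close> carries no multiplication.\<close>

typedef (overloaded) 'a endo = "UNIV :: ('a::real_normed_vector \<Rightarrow>\<^sub>L 'a) set"
  morphisms blinfun_of endo_of by simp

setup_lifting type_definition_endo

section \<open>The Banach algebra of endomorphisms\<close>

instantiation endo :: (real_normed_vector) real_normed_vector
begin
lift_definition zero_endo :: "'a endo" is 0 .
lift_definition plus_endo :: "'a endo \<Rightarrow> 'a endo \<Rightarrow> 'a endo" is "(+)" .
lift_definition minus_endo :: "'a endo \<Rightarrow> 'a endo \<Rightarrow> 'a endo" is "(-)" .
lift_definition uminus_endo :: "'a endo \<Rightarrow> 'a endo" is uminus .
lift_definition scaleR_endo :: "real \<Rightarrow> 'a endo \<Rightarrow> 'a endo" is "(*\<^sub>R)" .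
lift_definition norm_endo :: "'a endo \<Rightarrow> real" is norm .
definition dist_endo :: "'a endo \<Rightarrow> 'a endo \<Rightarrow> real" where "dist_endo S T = norm (S - T)"
definition sgn_endo :: "'a endo \<Rightarrow> 'a endo" where "sgn_endo T = inverse (norm T) *\<^sub>R T"
definition uniformity_endo :: "('a endo \<times> 'a endo) filter"
  where "uniformity_endo = (INF e\<in>{0<..}. principal {(x, y). dist x y < e})"
definition open_endo :: "'a endo set \<Rightarrow> bool"
  where "open_endo U \<longleftrightarrow> (\<forall>x\<in>U. \<forall>\<^sub>F (x', y) in uniformity. x' = x \<longrightarrow> y \<in> U)"
instance
  by standard
    (simp_all add: dist_endo_def sgn_endo_def uniformity_endo_def open_endo_def,
     (transfer; simp add: algebra_simps norm_triangle_ineq)+)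
end

instantiation endo :: (real_normed_vector) real_normed_algebra
begin
lift_definition times_endo :: "'a endo \<Rightarrow> 'a endo \<Rightarrow> 'a endo" is "(o\<^sub>L)" .
instance
  by standard
    (transfer; simp add: blinfun_eqI norm_blinfun_compose
      bounded_bilinear.add_left[OF bounded_bilinear_blinfun_compose]
      bounded_bilinear.add_right[OF bounded_bilinear_blinfun_compose]
      bounded_bilinear.scaleR_left[OF bounded_bilinear_blinfun_compose]
      bounded_bilinear.scaleR_right[OF bounded_bilinear_blinfun_compose])+
end

instance endo :: (banach) banach
proof
  fix X :: "nat \<Rightarrow> 'a endo"
  assume "Cauchy X"
  have dist: "dist (blinfun_of S) (blinfun_of T) = dist S T" for S T :: "'a endo"
    by (simp add: dist_norm norm_endo.rep_eq minus_endo.rep_eq)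
  then have "Cauchy (\<lambda>n. blinfun_of (X n))"
    using \<open>Cauchy X\<close> by (simp add: Cauchy_def)
  then obtain B where "(\<lambda>n. blinfun_of (X n)) \<longlonglongrightarrow> B"
    using Cauchy_convergent convergent_def by blast
  then have "X \<longlonglongrightarrow> endo_of B"
    unfolding tendsto_iff by (simp add: endo_of_inverse flip: dist)
  then show "convergent X"
    by (auto simp: convergent_def)
qed

lift_definition endo_id :: "'a::real_normed_vector endo" is id_blinfun .

lift_definition endo_app :: "'a::real_normed_vector endo \<Rightarrow> 'a \<Rightarrow> 'a" is blinfun_apply .

lemma endo_app_simps [simp]:
  "endo_app (S + T) x = endo_app S x + endo_app T x"
  "endo_app (S - T) x = endo_app S x - endo_app T x"
  "endo_app (- S) x = - endo_app S x"
  "endo_app (r *\<^sub>R S) x = r *\<^sub>R endo_app S x"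
  "endo_app (S * T) x = endo_app S (endo_app T x)"
  "endo_app endo_id x = x"
  by (transfer; simp add: blinfun.bilinear_simps)+

lemma endo_eqI: "(\<And>x. endo_app S x = endo_app T x) \<Longrightarrow> S = T"
  by transfer (rule blinfun_eqI)

lemma norm_endo_app: "norm (endo_app T x) \<le> norm T * norm x"
  by transfer (rule norm_blinfun)

lemma norm_endo_bound: "0 \<le> b \<Longrightarrow> (\<And>x. norm (endo_app T x) \<le> b * norm x) \<Longrightarrow> norm T \<le> b"
  by transfer (rule norm_blinfun_bound)

lemma endo_of_bounded_linear:
  assumes "bounded_linear g"
  obtains T where "\<And>x. endo_app T x = g x"
  using assms by (metis bounded_linear_Blinfun_apply endo_app.abs_eq)

lemma bounded_linear_endo_app: "bounded_linear (\<lambda>T. endo_app T x)"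
  by (rule bounded_linear_intro[of _ "norm x"]) (simp_all add: norm_endo_app)

section \<open>C*-algebras and their adjointable operators\<close>

locale cstar =
  fixes sc :: "complex \<Rightarrow> 'a::{real_normed_algebra,banach} \<Rightarrow> 'a" and st :: "'a \<Rightarrow> 'a"
  assumes cstar_algebra: "cstar_algebra sc st"
begin

lemma
  shows sc_add: "sc c (a + b) = sc c a + sc c b"
    and sc_sc: "sc c (sc d a) = sc (c * d) a"
    and sc_of_real: "sc (complex_of_real r) a = r *\<^sub>R a"
    and sc_mult_left: "sc c a * b = sc c (a * b)"
    and sc_mult_right: "a * sc c b = sc c (a * b)"
    and norm_sc: "norm (sc c a) = cmod c * norm a"
    and st_add: "st (a + b) = st a + st b"
    and st_sc: "st (sc c a) = sc (cnj c) (st a)"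
    and st_mult: "st (a * b) = st b * st a"
    and st_st [simp]: "st (st a) = a"
    and norm_st_mult: "norm (st a * a) = (norm a)\<^sup>2"
  using cstar_algebra unfolding cstar_algebra_def by auto

lemma sc_scaleR: "sc c (r *\<^sub>R a) = r *\<^sub>R sc c a"
  by (metis sc_of_real sc_sc mult.commute)

lemma sc_minus: "sc c (- a) = - sc c a"
  using sc_scaleR[of c "-1" a] by simp

lemma sc_diff: "sc c (a - b) = sc c a - sc c b"
  using sc_add[of c a "- b"] by (simp add: sc_minus)

lemma sc_minus_left: "sc (- c) a = - sc c a"
  using sc_of_real[of "-1" "sc c a"] by (simp add: sc_sc)

lemma sc_1 [simp]: "sc 1 a = a"
  using sc_of_real[of 1 a] by simp

lemma st_scaleR: "st (r *\<^sub>R a) = r *\<^sub>R st a"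
  by (metis sc_of_real st_sc complex_cnj_complex_of_real)

lemma norm_st [simp]: "norm (st a) = norm a"
proof -
  have "norm a \<le> norm (st a)" for a
  proof (cases "norm a = 0")
    case False
    have "(norm a)\<^sup>2 \<le> norm (st a) * norm a"
      using norm_st_mult norm_mult_ineq by metis
    with False show ?thesis by (simp add: power2_eq_square)
  qed simp
  then show ?thesis by (metis order_antisym st_st)
qed

lemma bounded_linear_st: "bounded_linear st"
  by (rule bounded_linear_intro[of _ 1]) (simp_all add: st_add st_scaleR)

text \<open>Testing with \<open>y = a - b\<close> and the C*-identity separates points even without
  a unit.\<close>

lemma eq_if_st_mult_eq:
  assumes "\<And>y. st a * y = st b * y"
  shows "a = b"
proof -
  have "st (a - b) * (a - b) = 0"
    using assms[of "a - b"] bounded_linear.linear[OF bounded_linear_st]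
    by (simp add: linear_diff left_diff_distrib)
  then show ?thesis
    using norm_st_mult[of "a - b"] by simp
qed

text \<open>The adjointable operators on \<open>\<A>\<close>, viewed as a Hilbert module over itself, supply the unit
  that \<open>\<A>\<close> may lack.\<close>

definition adjoint :: "'a endo \<Rightarrow> 'a endo \<Rightarrow> bool" where
  "adjoint T S \<longleftrightarrow> (\<forall>x y. st (endo_app T x) * y = st x * endo_app S y)"

lemma adjoint_algebra:
  obtains J where "adjoint_algebra adjoint endo_id J"
proof -
  have "bounded_linear (sc \<i>)"
    by (rule bounded_linear_intro[of _ 1]) (simp_all add: sc_add sc_scaleR norm_sc)
  then obtain J where J: "\<And>x. endo_app J x = sc \<i> x"
    using endo_of_bounded_linear by blast
  have "adjoint_algebra adjoint endo_id J"
  proof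
    fix x x' y y' :: "'a endo" and r :: real
    show sym: "adjoint x' x" if "adjoint x x'"
      using that unfolding adjoint_def by (metis st_mult st_st)
    show "adjoint (x + y) (x' + y')" if "adjoint x x'" "adjoint y y'"
      using that by (simp add: adjoint_def st_add algebra_simps)
    show "adjoint (r *\<^sub>R x) (r *\<^sub>R x')" if "adjoint x x'"
      using that by (simp add: adjoint_def st_scaleR)
    show "adjoint (x * y) (y' * x')" if "adjoint x x'" "adjoint y y'"
      using that by (simp add: adjoint_def)
    show "endo_id * x = x" "x * endo_id = x"
      by (rule endo_eqI; simp)+
    show "adjoint endo_id endo_id"
      by (simp add: adjoint_def)
    have cont: "continuous_on UNIV (\<lambda>T. st (endo_app T u) * v)"
      "continuous_on UNIV (\<lambda>T. st u * endo_app T v)" for u v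
      by (intro continuous_intros bounded_linear.continuous_on[OF bounded_linear_st]
          bounded_linear.continuous_on[OF bounded_linear_endo_app])+
    show "closed {x. adjoint x x}"
      unfolding adjoint_def by (intro closed_Collect_all closed_Collect_eq cont)
    \<comment> \<open>Apply the C*-identity of the algebra to each value \<open>endo_app x a\<close>
      and move \<open>x\<close> across as \<open>x'\<close>.\<close>
    show "(norm x)\<^sup>2 \<le> norm (x' * x)" if "adjoint x x'"
    proof -
      have "norm (endo_app x a) \<le> sqrt (norm (x' * x)) * norm a" for a
      proof -
        have "(norm (endo_app x a))\<^sup>2 = norm (st a * endo_app (x' * x) a)"
          using that by (simp add: adjoint_def flip: norm_st_mult)
        also have "\<dots> \<le> norm a * (norm (x' * x) * norm a)"
          using norm_mult_ineq[of "st a"] mult_left_mono[OF norm_endo_app[of "x' * x" a] norm_ge_zero[of a]]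
          by (metis norm_st order_trans)
        also have "\<dots> = (sqrt (norm (x' * x)) * norm a)\<^sup>2"
          by (simp add: power_mult_distrib power2_eq_square)
        finally show ?thesis
          by (rule power2_le_imp_le) simp
      qed
      then have "norm x \<le> sqrt (norm (x' * x))"
        by (intro norm_endo_bound) auto
      then have "(norm x)\<^sup>2 \<le> (sqrt (norm (x' * x)))\<^sup>2"
        by (intro power_mono) auto
      then show ?thesis by simp
    qed
    show "norm (endo_id :: 'a endo) \<le> 1"
      by (rule norm_endo_bound) auto
    show "J * J = - endo_id"
      by (rule endo_eqI) (simp add: J sc_sc sc_minus_left)
    show "adjoint J (- J)"
      by (simp add: adjoint_def J st_sc sc_minus_left sc_mult_left sc_mult_right)
    \<comment> \<open>An operator with an adjoint is complex-linear, although \<open>endo\<close>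
      contains all bounded real-linear maps.\<close>
    show "J * x = x * J" if "adjoint x x'"
    proof (rule endo_eqI)
      fix a
      have "st (endo_app x (sc \<i> a)) * b = st (sc \<i> (endo_app x a)) * b" for b
        using that by (simp add: adjoint_def st_sc sc_mult_left)
      then have "endo_app x (sc \<i> a) = sc \<i> (endo_app x a)"
        by (rule eq_if_st_mult_eq)
      then show "endo_app (J * x) a = endo_app (x * J) a"
        by (simp add: J)
    qed
  qed
  then show thesis by (rule that)
qed

text \<open>Left multiplication \<open>M\<close> respects products, sums and adjoints and is
  isometric: testing \<open>M a\<close> on \<open>st a\<close> gives
  \<open>norm a \<le> norm (M a)\<close>, and submultiplicativity gives the reverse. The inequality
  for operators thus transfers back.\<close>

theorem norm_st_mult_le_sum: "norm (st a * a) \<le> norm (st a * a + st b * b)"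
proof -
  have "\<exists>T. \<forall>x. endo_app T x = c * x" for c :: 'a
    using endo_of_bounded_linear[OF bounded_linear_mult_right[of c]] by blast
  then obtain M :: "'a \<Rightarrow> 'a endo" where M: "\<And>c x. endo_app (M c) x = c * x"
    by metis
  have adj: "adjoint (M c) (M (st c))" for c
    by (simp add: adjoint_def M st_mult mult.assoc)
  obtain J where "adjoint_algebra adjoint endo_id J"
    by (rule adjoint_algebra)
  then interpret adjoint_algebra adjoint endo_id J .
  have eq: "M (st a) * M a + M (st b) * M b = M (st a * a + st b * b)"
    by (rule endo_eqI) (simp add: M algebra_simps)
  have "norm a \<le> norm (M a)"
  proof (cases "norm a = 0")
    case False
    have "(norm a)\<^sup>2 = norm (endo_app (M a) (st a))"
      using norm_st_mult[of "st a"] by (simp add: M)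
    also have "\<dots> \<le> norm (M a) * norm a"
      using norm_endo_app[of "M a" "st a"] by simp
    finally show ?thesis
      using False by (simp add: power2_eq_square)
  qed simp
  then have "norm (st a * a) \<le> (norm (M a))\<^sup>2"
    by (simp add: norm_st_mult power_mono)
  also have "\<dots> \<le> norm (M (st a * a + st b * b))"
    using norm_adj_mult_le_sum[OF adj adj, of a b] by (simp add: eq)
  also have "\<dots> \<le> norm (st a * a + st b * b)"
    by (intro norm_endo_bound) (auto simp: M norm_mult_ineq)
  finally show ?thesis .
qed

end

section \<open>Hilbert modules\<close>

locale cstar_module = cstar sc st
  for sc :: "complex \<Rightarrow> 'a::{real_normed_algebra,banach} \<Rightarrow> 'a" and st :: "'a \<Rightarrow> 'a" +
  fixes sX :: "complex \<Rightarrow> 'x::ab_group_add \<Rightarrow> 'x" and act :: "'a \<Rightarrow> 'x \<Rightarrow> 'x" and ip :: "'x \<Rightarrow> 'x \<Rightarrow> 'a"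
  assumes hilbert_module: "hilbert_module sc st sX act ip"
begin

lemma
  shows sX_add: "sX c (x + y) = sX c x + sX c y"
    and sX_add_left: "sX (c + d) x = sX c x + sX d x"
    and sX_sX: "sX c (sX d x) = sX (c * d) x"
    and sX_1 [simp]: "sX 1 x = x"
    and act_add: "act a (x + y) = act a x + act a y"
    and act_add_left: "act (a + b) x = act a x + act b x"
    and act_sc: "act (sc c a) x = sX c (act a x)"
    and act_sX: "act a (sX c x) = sX c (act a x)"
    and ip_add_left: "ip (x + y) z = ip x z + ip y z"
    and ip_sX_left: "ip (sX c x) y = sc c (ip x y)"
    and ip_act_left: "ip (act a x) y = a * ip x y"
    and st_ip: "st (ip x y) = ip y x"
    and ip_self_nonneg: "cstar_nonneg st (ip x x)"
    and ip_self_eq_0: "ip x x = 0 \<longleftrightarrow> x = 0"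
  using hilbert_module unfolding hilbert_module_def by metis+

lemma complete:
  assumes "\<And>e. 0 < e \<Longrightarrow> \<exists>N. \<forall>m\<ge>N. \<forall>n\<ge>N. hnorm ip (X m - X n) < e"
  shows "\<exists>l. (\<lambda>n. hnorm ip (X n - l)) \<longlonglongrightarrow> 0"
proof -
  have "\<forall>X::nat \<Rightarrow> 'x. (\<forall>e>0. \<exists>N. \<forall>m\<ge>N. \<forall>n\<ge>N. hnorm ip (X m - X n) < e) \<longrightarrow>
      (\<exists>l. (\<lambda>n. hnorm ip (X n - l)) \<longlonglongrightarrow> 0)"
    using hilbert_module unfolding hilbert_module_def by (elim conjE) assumption
  then show ?thesis using assms by simp
qed

lemma sX_zero_right [simp]: "sX c 0 = 0"
  using sX_add[of c 0 0] by simp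

lemma sX_zero_left [simp]: "sX 0 x = 0"
  using sX_add_left[of 0 0 x] by simp

lemma sX_minus: "sX c (- x) = - sX c x"
  using minus_unique[of "sX c x" "sX c (- x)"] sX_add[of c x "- x"] by simp

lemma sX_minus_left: "sX (- c) x = - sX c x"
  using minus_unique[of "sX c x" "sX (- c) x"] sX_add_left[of c "- c" x] by simp

lemma sX_diff: "sX c (x - y) = sX c x - sX c y"
  using sX_add[of c x "- y"] by (simp add: sX_minus)

lemma act_diff: "act a (x - y) = act a x - act a y"
  using act_add[of a "x - y" y] by (simp add: algebra_simps)

lemma act_diff_left: "act (a - b) x = act a x - act b x"
  using act_add_left[of "a - b" b x] by (simp add: algebra_simps)

lemma ip_add_right: "ip x (y + z) = ip x y + ip x z"
  using st_ip st_add ip_add_left by metis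

lemma ip_sX_right: "ip x (sX c y) = sc (cnj c) (ip x y)"
  using st_ip st_sc ip_sX_left by metis

lemma ip_diff_left: "ip (x - y) z = ip x z - ip y z"
  using ip_add_left[of "x - y" y z] by (simp add: algebra_simps)

lemma ip_diff_right: "ip z (x - y) = ip z x - ip z y"
  using ip_add_right[of z "x - y" y] by (simp add: algebra_simps)

section \<open>The module norm\<close>

lemma hnorm_nonneg: "0 \<le> hnorm ip x"
  by (simp add: hnorm_def)

lemma hnorm_power2: "(hnorm ip x)\<^sup>2 = norm (ip x x)"
  by (simp add: hnorm_def)

lemma hnorm_eq_0: "hnorm ip x = 0 \<longleftrightarrow> x = 0"
  by (simp add: hnorm_def ip_self_eq_0)

lemma hnorm_zero [simp]: "hnorm ip 0 = 0"
  by (simp add: hnorm_eq_0)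

lemma hnorm_sX: "hnorm ip (sX c x) = cmod c * hnorm ip x"
  by (simp add: hnorm_def ip_sX_left ip_sX_right sc_sc norm_sc norm_mult real_sqrt_mult)

lemma hnorm_minus_commute: "hnorm ip (x - y) = hnorm ip (y - x)"
  using hnorm_sX[of "-1" "x - y"] by (simp add: sX_minus_left)

lemma hnorm_act: "hnorm ip (act a x) \<le> norm a * hnorm ip x"
proof -
  have "ip (act a x) (act a x) = a * ip x x * st a"
    by (metis ip_act_left st_ip st_mult mult.assoc)
  then have "norm (ip (act a x) (act a x)) \<le> norm a * norm (ip x x) * norm a"
    using norm_mult_ineq[of "a * ip x x" "st a"]
      mult_right_mono[OF norm_mult_ineq[of a "ip x x"] norm_ge_zero[of a]] by simp
  then have "(hnorm ip (act a x))\<^sup>2 \<le> (norm a * hnorm ip x)\<^sup>2"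
    by (simp add: power_mult_distrib hnorm_power2 power2_eq_square[of "norm a"] mult_ac)
  then show ?thesis
    by (rule power2_le_imp_le) (simp add: hnorm_nonneg)
qed

lemma norm_ip_self_le_sum: "norm (ip x x) \<le> norm (ip x x + ip y y)"
  using ip_self_nonneg[of x] ip_self_nonneg[of y] norm_st_mult_le_sum
  unfolding cstar_nonneg_def by metis

text \<open>No Cauchy--Schwarz inequality is needed: for \<open>r > 0\<close>, expanding
  \<open>\<langle>x + y, x + y\<rangle> + \<langle>\<surd>r x - y / \<surd>r, \<surd>r x - y / \<surd>r\<rangle> = (1 + r) \<langle>x, x\<rangle> + (1 + 1 / r) \<langle>y, y\<rangle>\<close>
  and dropping the second positive summand bounds \<open>\<parallel>x + y\<parallel>\<^sup>2\<close>; then take \<open>r = \<parallel>y\<parallel> / \<parallel>x\<parallel>\<close>.\<close>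

lemma hnorm_triangle: "hnorm ip (x + y) \<le> hnorm ip x + hnorm ip y"
proof (cases "x = 0 \<or> y = 0")
  case False
  define a where "a = hnorm ip x"
  define b where "b = hnorm ip y"
  have pos: "0 < a" "0 < b"
    using False hnorm_nonneg hnorm_eq_0 unfolding a_def b_def by (metis order_le_less)+
  define r where "r = b / a"
  have r: "0 < r" using pos by (simp add: r_def)
  define c where "c = sqrt r"
  define d where "d = 1 / sqrt r"
  have cd: "c * c = r" "d * d = 1 / r" "c * d = 1" "d * c = 1"
    using r by (simp_all add: c_def d_def)
  define z where "z = sX (complex_of_real c) x - sX (complex_of_real d) y"
  have "ip z z = r *\<^sub>R ip x x + (1/r) *\<^sub>R ip y y - ip x y - ip y x"
    by (simp add: z_def ip_diff_left ip_diff_right ip_sX_left ip_sX_right sc_of_real cd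
        scaleR_right_diff_distrib)
  then have eq: "ip (x + y) (x + y) + ip z z = (1 + r) *\<^sub>R ip x x + (1 + 1/r) *\<^sub>R ip y y"
    by (simp add: ip_add_left ip_add_right algebra_simps)
  have "(hnorm ip (x + y))\<^sup>2 \<le> norm (ip (x + y) (x + y) + ip z z)"
    unfolding hnorm_power2 by (rule norm_ip_self_le_sum)
  also have "\<dots> \<le> norm ((1 + r) *\<^sub>R ip x x) + norm ((1 + 1/r) *\<^sub>R ip y y)"
    unfolding eq by (rule norm_triangle_ineq)
  also have "\<dots> = (1 + r) * a\<^sup>2 + (1 + 1/r) * b\<^sup>2"
    using r by (simp add: a_def b_def hnorm_power2)
  also have "\<dots> = (a + b)\<^sup>2"
    using pos by (simp add: r_def field_simps power2_eq_square)
  finally show ?thesis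
    unfolding a_def b_def by (rule power2_le_imp_le) (simp add: hnorm_nonneg)
qed auto

lemma hnorm_triangle_diff: "hnorm ip (x - z) \<le> hnorm ip (x - y) + hnorm ip (y - z)"
  using hnorm_triangle[of "x - y" "y - z"] by simp

text \<open>A crude Cauchy-Schwarz bound by polarization, sufficient for continuity of
  \<open>ip\<close>. On unit vectors each symmetrized product has norm at most 4 + 2, and twice
  \<open>ip u v\<close> combines two of them, so 8 is generous.\<close>

lemma norm_ip_le: "norm (ip x y) \<le> 8 * hnorm ip x * hnorm ip y"
proof (cases "x = 0 \<or> y = 0")
  case True
  then have "ip x y = 0"
    using ip_diff_left[of x x y] ip_diff_right[of x y y] by auto
  then show ?thesis by (simp add: hnorm_nonneg)
next
  case False
  have re: "norm (ip u v + ip v u) \<le> 6" if "hnorm ip u = 1" "hnorm ip v = 1" for u v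
  proof -
    have "(hnorm ip (u + v))\<^sup>2 \<le> 2\<^sup>2"
      using hnorm_triangle[of u v] that by (intro power_mono) (auto simp: hnorm_nonneg)
    moreover have "ip u v + ip v u = ip (u + v) (u + v) - (ip u u + ip v v)"
      by (simp add: ip_add_left ip_add_right)
    ultimately show ?thesis
      using that hnorm_power2[of u] hnorm_power2[of v] norm_triangle_ineq[of "ip u u" "ip v v"]
        norm_triangle_ineq4[of "ip (u + v) (u + v)" "ip u u + ip v v"]
      by (simp add: hnorm_power2)
  qed
  have unit: "norm (ip u v) \<le> 8" if uv: "hnorm ip u = 1" "hnorm ip v = 1" for u v
  proof -
    let ?w = "sX \<i> u"
    have "ip u v + ip u v = (ip u v + ip v u) - sc \<i> (ip ?w v + ip v ?w)"
      by (simp add: ip_sX_left ip_sX_right sc_add sc_diff sc_sc sc_minus_left)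
    moreover have "norm (ip ?w v + ip v ?w) \<le> 6"
      using uv by (intro re) (auto simp: hnorm_sX)
    then have "norm (sc \<i> (ip ?w v + ip v ?w)) \<le> 6"
      by (simp add: norm_sc)
    ultimately have "norm (2 *\<^sub>R ip u v) \<le> 6 + 6"
      using re[OF uv] norm_triangle_ineq4 by (smt (verit) scaleR_2)
    then show ?thesis by simp
  qed
  define a where "a = hnorm ip x"
  define b where "b = hnorm ip y"
  have pos: "0 < a" "0 < b"
    using False hnorm_nonneg hnorm_eq_0 unfolding a_def b_def by (metis order_le_less)+
  have "norm (ip (sX (complex_of_real (1/a)) x) (sX (complex_of_real (1/b)) y)) \<le> 8"
    using pos by (intro unit) (auto simp: hnorm_sX norm_divide a_def b_def)
  then have "norm (ip x y) / (a * b) \<le> 8"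
    using pos by (simp add: ip_sX_left ip_sX_right sc_sc norm_sc norm_mult norm_divide mult.commute)
  then show ?thesis
    using pos by (simp add: field_simps flip: a_def b_def)
qed

section \<open>Convergence in the module norm\<close>

definition conv :: "(nat \<Rightarrow> 'x) \<Rightarrow> 'x \<Rightarrow> bool" where
  "conv X l \<longleftrightarrow> (\<lambda>n. hnorm ip (X n - l)) \<longlonglongrightarrow> 0"

lemma hnorm_le_tendsto_0:
  assumes "\<And>n. hnorm ip (X n) \<le> r n" "r \<longlonglongrightarrow> 0"
  shows "(\<lambda>n. hnorm ip (X n)) \<longlonglongrightarrow> 0"
  using assms(1) hnorm_nonneg
  by (intro tendsto_sandwich[OF always_eventually always_eventually tendsto_const assms(2)] allI)

text \<open>Asymptotically equal sequences have equal limits; this is how the approximate identities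
  for \<open>f\<close> become exact ones for \<open>H\<close>.\<close>

lemma conv_eq_lim:
  assumes "conv X l" "conv Y m" "(\<lambda>n. hnorm ip (X n - Y n)) \<longlonglongrightarrow> 0"
  shows "l = m"
proof -
  have "(\<lambda>n. hnorm ip (X n - l) + hnorm ip (X n - Y n) + hnorm ip (Y n - m)) \<longlonglongrightarrow> 0 + 0 + 0"
    using assms unfolding conv_def by (intro tendsto_add)
  moreover have "hnorm ip (l - m) \<le> hnorm ip (X n - l) + hnorm ip (X n - Y n) + hnorm ip (Y n - m)" for n
    using hnorm_triangle_diff[of l m "X n"] hnorm_triangle_diff[of "X n" m "Y n"]
      hnorm_minus_commute[of l "X n"] by linarith
  ultimately have "hnorm ip (l - m) \<le> 0"
    by (intro LIMSEQ_le_const) auto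
  then show ?thesis
    using hnorm_nonneg[of "l - m"] hnorm_eq_0[of "l - m"] by simp
qed

lemma conv_add:
  assumes "conv X l" "conv Y m"
  shows "conv (\<lambda>n. X n + Y n) (l + m)"
  unfolding conv_def
proof (rule hnorm_le_tendsto_0)
  show "hnorm ip (X n + Y n - (l + m)) \<le> hnorm ip (X n - l) + hnorm ip (Y n - m)" for n
    using hnorm_triangle[of "X n - l" "Y n - m"] by (simp add: algebra_simps)
  show "(\<lambda>n. hnorm ip (X n - l) + hnorm ip (Y n - m)) \<longlonglongrightarrow> 0"
    using assms tendsto_add[of _ 0 _ _ 0] unfolding conv_def by fastforce
qed

lemma conv_sX:
  assumes "conv X l"
  shows "conv (\<lambda>n. sX c (X n)) (sX c l)"
  using assms tendsto_mult_left[of _ 0 _ "cmod c"]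
  by (simp add: conv_def hnorm_sX flip: sX_diff)

lemma conv_bounded:
  assumes "conv X l"
  shows "\<exists>B. \<forall>n. hnorm ip (X n) \<le> B"
proof -
  obtain B where "\<And>n. norm (hnorm ip (X n - l)) \<le> B"
    using assms convergent_imp_Bseq[of "\<lambda>n. hnorm ip (X n - l)"]
    unfolding conv_def convergent_def Bseq_def by blast
  then have "hnorm ip (X n) \<le> B + hnorm ip l" for n
    using hnorm_triangle[of "X n - l" l] hnorm_nonneg[of "X n - l"] by (smt (verit) diff_add_cancel real_norm_def)
  then show ?thesis by blast
qed

lemma conv_ip:
  assumes "conv X l" "conv Y m"
  shows "(\<lambda>n. ip (X n) (Y n)) \<longlonglongrightarrow> ip l m"
proof -
  obtain B where B: "\<And>n. hnorm ip (Y n) \<le> B"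
    using conv_bounded[OF assms(2)] by blast
  let ?r = "\<lambda>n. 8 * hnorm ip (X n - l) * B + 8 * hnorm ip l * hnorm ip (Y n - m)"
  have "?r \<longlonglongrightarrow> 8 * 0 * B + 8 * hnorm ip l * 0"
    using assms unfolding conv_def by (intro tendsto_intros)
  then have r: "?r \<longlonglongrightarrow> 0" by simp
  have bound: "norm (ip (X n) (Y n) - ip l m) \<le> ?r n" for n
  proof -
    have "ip (X n) (Y n) - ip l m = ip (X n - l) (Y n) + ip l (Y n - m)"
      by (simp add: ip_diff_left ip_diff_right)
    then have "norm (ip (X n) (Y n) - ip l m)
        \<le> 8 * hnorm ip (X n - l) * hnorm ip (Y n) + 8 * hnorm ip l * hnorm ip (Y n - m)"
      using norm_ip_le[of "X n - l" "Y n"] norm_ip_le[of l "Y n - m"] norm_triangle_mono by metis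
    also have "\<dots> \<le> ?r n"
      using B[of n] by (intro add_right_mono mult_left_mono) (auto simp: hnorm_nonneg)
    finally show ?thesis .
  qed
  have "(\<lambda>n. ip (X n) (Y n) - ip l m) \<longlonglongrightarrow> 0"
    using bound by (intro Lim_null_comparison[OF always_eventually r] allI)
  then show ?thesis by (rule LIM_zero_cancel)
qed

lemma conv_act:
  assumes "a \<longlonglongrightarrow> b" "conv X l"
  shows "conv (\<lambda>n. act (a n) (X n)) (act b l)"
  unfolding conv_def
proof (rule hnorm_le_tendsto_0)
  let ?r = "\<lambda>n. norm (a n) * hnorm ip (X n - l) + norm (a n - b) * hnorm ip l"
  show "hnorm ip (act (a n) (X n) - act b l) \<le> ?r n" for n
  proof -
    have "act (a n) (X n) - act b l = act (a n) (X n - l) + act (a n - b) l"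
      by (simp add: act_diff act_diff_left)
    then show ?thesis
      using hnorm_triangle[of "act (a n) (X n - l)" "act (a n - b) l"]
        hnorm_act[of "a n" "X n - l"] hnorm_act[of "a n - b" l] by simp
  qed
  have "?r \<longlonglongrightarrow> norm b * 0 + norm (b - b) * hnorm ip l"
    using assms unfolding conv_def by (intro tendsto_intros)
  then show "?r \<longlonglongrightarrow> 0" by simp
qed

end

text \<open>The modulus of \<open>c\<close> is 2 cos \<open>\<theta>\<close>, the sum of two
  conjugate unimodular numbers; rotate both by the argument of \<open>c\<close>. This extends
  homogeneity from unimodular to all scalars.\<close>

lemma sum_of_two_unimodular:
  assumes "cmod c \<le> 2"
  obtains \<mu> \<nu> where "cmod \<mu> = 1" "cmod \<nu> = 1" "c = \<mu> + \<nu>"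
proof -
  define \<theta> where "\<theta> = arccos (cmod c / 2)"
  have "cos \<theta> = cmod c / 2"
    unfolding \<theta>_def using assms norm_ge_zero[of c] by (intro cos_arccos) linarith+
  then have "cis \<theta> + cis (- \<theta>) = cmod c"
    by (simp add: complex_eq_iff)
  then have "c = cis (Arg c) * cis \<theta> + cis (Arg c) * cis (- \<theta>)"
    using rcis_cmod_Arg[of c] by (metis rcis_def mult.commute distrib_left)
  then show thesis
    by (intro that[of "cis (Arg c) * cis \<theta>" "cis (Arg c) * cis (- \<theta>)"]) (auto simp: norm_mult)
qed

section \<open>The stability theorem\<close>

theorem theorem3p3:
  fixes sA :: "complex \<Rightarrow> 'a::{real_normed_algebra,banach} \<Rightarrow> 'a" and stA :: "'a \<Rightarrow> 'a"
    and sB :: "complex \<Rightarrow> 'b::{real_normed_algebra,banach} \<Rightarrow> 'b" and stB :: "'b \<Rightarrow> 'b"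
    and sX :: "complex \<Rightarrow> 'x::ab_group_add \<Rightarrow> 'x" and actX :: "'a \<Rightarrow> 'x \<Rightarrow> 'x" and ipX :: "'x \<Rightarrow> 'x \<Rightarrow> 'a"
    and sY :: "complex \<Rightarrow> 'y::ab_group_add \<Rightarrow> 'y" and actY :: "'b \<Rightarrow> 'y \<Rightarrow> 'y" and ipY :: "'y \<Rightarrow> 'y \<Rightarrow> 'b"
    and f :: "'x \<Rightarrow> 'y" and \<phi> :: "'x \<Rightarrow> 'x \<Rightarrow> 'x \<Rightarrow> real" and L :: real
  assumes "cstar_algebra sA stA" and "cstar_algebra sB stB"
    and "hilbert_module sA stA sX actX ipX" and "hilbert_module sB stB sY actY ipY"
    and "\<forall>x y z. \<phi> x y z \<ge> 0"
    and "\<forall>\<mu> x y. cmod \<mu> = 1 \<longrightarrow> hnorm ipY (f (sX \<mu> x + y) - sY \<mu> (f x) - f y) \<le> \<phi> x y 0"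
    and "\<forall>x y z. hnorm ipY (f (actX (ipX x y) z) - actY (ipY (f x) (f y)) (f z)) \<le> \<phi> x y z"
    and "\<forall>x y z. hnorm ipY (f (actX (stA (ipX x y)) z) - actY (stB (ipY (f x) (f y))) (f z)) \<le> \<phi> x y z"
    and "0 \<le> L" and "L < 1"
    and "\<forall>x y z. \<phi> x y z \<le> L / 8 * \<phi> (sX 2 x) (sX 2 y) (sX 2 z)"
  shows "\<exists>!H. hm_star_hom stA stB sX actX ipX sY actY ipY H \<and>
           (\<forall>x. hnorm ipY (f x - H x) \<le> L / (8 - 8 * L) * \<phi> x x 0)"
proof -
  interpret X: cstar_module sA stA sX actX ipX
    using assms(1,3) by unfold_locales
  interpret Y: cstar_module sB stB sY actY ipY
    using assms(2,4) by unfold_locales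
  note \<phi>_nonneg = assms(5)[rule_format] and f_lin = assms(6)[rule_format]
    and f_hom = assms(7)[rule_format] and L = assms(9,10) and \<phi>_half = assms(11)[rule_format]
  define K where "K = L / (8 - 8 * L)"
  have "0 \<le> K" using L by (simp add: K_def)
  define s where "s n = sX (1 / 2 ^ n)" for n
  define g where "g n x = sY (2 ^ n) (f (s n x))" for n x
  have s_s: "s m (s n x) = s (m + n) x" for m n x
    by (simp add: s_def X.sX_sX power_add)
  have s_add: "s n (x + y) = s n x + s n y" for n x y
    by (simp add: s_def X.sX_add)
  have s_sX: "s n (sX c x) = sX c (s n x)" for n c x
    by (simp add: s_def X.sX_sX mult.commute)
  have s_zero: "s n 0 = 0" for n
    by (simp add: s_def)
  have \<phi>_s: "\<phi> (s n x) (s n y) (s n z) \<le> (L / 8) ^ n * \<phi> x y z" for n x y z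
  proof (induction n)
    case 0
    show ?case by (simp add: s_def)
  next
    case (Suc n)
    have two: "sX 2 (s (Suc n) u) = s n u" for u
      by (simp add: s_def X.sX_sX)
    have "\<phi> (s (Suc n) x) (s (Suc n) y) (s (Suc n) z) \<le> L / 8 * \<phi> (s n x) (s n y) (s n z)"
      using \<phi>_half[of "s (Suc n) x" "s (Suc n) y" "s (Suc n) z"] by (simp only: two)
    also have "\<dots> \<le> L / 8 * ((L / 8) ^ n * \<phi> x y z)"
      using Suc L by (intro mult_left_mono) auto
    finally show ?case by simp
  qed
  have \<phi>_s0: "\<phi> (s n x) (s n y) 0 \<le> (L / 8) ^ n * \<phi> x y 0" for n x y
    using \<phi>_s[of n x y 0] by (simp add: s_zero)
  \<comment> \<open>The linear estimates use \<open>q = 2\<close> and the trilinear one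
    \<open>q = 8\<close>; in both cases \<open>q * (L / 8) \<le> L < 1\<close>.\<close>
  have to_0: "(\<lambda>n. C * (q ^ n * (L / 8) ^ n * c)) \<longlonglongrightarrow> 0" if "0 \<le> q" "q \<le> 8" for q C c
  proof -
    have "q * (L / 8) < 1"
      using that L mult_right_mono[of q 8 "L / 8"] by simp
    then have p: "(\<lambda>n. (q * (L / 8)) ^ n) \<longlonglongrightarrow> 0"
      using that L by (intro LIMSEQ_realpow_zero) auto
    have "(\<lambda>n. C * ((q * (L / 8)) ^ n * c)) \<longlonglongrightarrow> C * (0 * c)"
      by (intro tendsto_mult tendsto_const p)
    then show ?thesis by (simp only: power_mult_distrib mult_zero_left mult_zero_right)
  qed
  \<comment> \<open>Induction with \<open>x\<close> arbitrary avoids summing a series: pass from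
    \<open>x\<close> to its half and use that \<open>K\<close> satisfies
    \<open>(1 + 2 * K) * (L / 8) \<le> K\<close>.\<close>
  have fg: "hnorm ipY (f x - g n x) \<le> K * \<phi> x x 0" for n x
  proof (induction n arbitrary: x)
    case 0
    show ?case using \<open>0 \<le> K\<close> \<phi>_nonneg by (simp add: g_def s_def)
  next
    case (Suc n)
    let ?u = "s (Suc 0) x"
    have half: "?u + ?u = x"
      by (simp add: s_def flip: X.sX_add_left)
    have "g (Suc n) x = sY 2 (g n ?u)"
      by (simp add: g_def s_s Y.sX_sX)
    then have "f x - g (Suc n) x = (f (sX 1 ?u + ?u) - sY 1 (f ?u) - f ?u) + sY 2 (f ?u - g n ?u)"
      using Y.sX_add_left[of 1 1 "f ?u"] by (simp add: half Y.sX_diff)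
    then have "hnorm ipY (f x - g (Suc n) x) \<le> \<phi> ?u ?u 0 + 2 * hnorm ipY (f ?u - g n ?u)"
      using Y.hnorm_triangle[of "f (sX 1 ?u + ?u) - sY 1 (f ?u) - f ?u" "sY 2 (f ?u - g n ?u)"]
        f_lin[of 1 ?u ?u] by (simp add: Y.hnorm_sX)
    also have "\<dots> \<le> (1 + 2 * K) * \<phi> ?u ?u 0"
      using Suc[of ?u] by (simp add: algebra_simps)
    also have "\<dots> \<le> (1 + 2 * K) * (L / 8 * \<phi> x x 0)"
      using \<phi>_s0[of 1 x x] \<open>0 \<le> K\<close> by (intro mult_left_mono) auto
    also have "\<dots> = ((1 + 2 * K) * (L / 8)) * \<phi> x x 0"
      by simp
    also have "\<dots> \<le> K * \<phi> x x 0"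
    proof (rule mult_right_mono[OF _ \<phi>_nonneg])
      have "(1 + 2 * K) * (8 - 8 * L) = 8 - 6 * L"
        using L by (simp add: K_def field_simps)
      then have "(1 + 2 * K) * (L / 8) * (8 - 8 * L) = (8 - 6 * L) * (L / 8)"
        by (metis mult.assoc mult.commute)
      also have "\<dots> \<le> 8 * (L / 8)"
        using L by (intro mult_right_mono) auto
      also have "\<dots> = K * (8 - 8 * L)"
        using L by (simp add: K_def)
      finally show "(1 + 2 * K) * (L / 8) \<le> K"
        using L by (simp add: mult_le_cancel_right)
    qed
    finally show ?case .
  qed
  \<comment> \<open>Since \<open>g (m + n) x\<close> is \<open>2 ^ m\<close> times
    \<open>g n (s m x)\<close>, this is \<open>fg\<close> at the rescaled point.\<close>
  have g_Cauchy: "hnorm ipY (g m x - g (m + n) x) \<le> K * (2 ^ m * (L / 8) ^ m * \<phi> x x 0)" for m n x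
  proof -
    have "g (m + n) x = sY (2 ^ m) (g n (s m x))"
      by (simp add: g_def s_s Y.sX_sX power_add add.commute)
    then have "hnorm ipY (g m x - g (m + n) x) = 2 ^ m * hnorm ipY (f (s m x) - g n (s m x))"
      by (simp add: g_def[of m] Y.hnorm_sX norm_power flip: Y.sX_diff)
    also have "\<dots> \<le> 2 ^ m * (K * ((L / 8) ^ m * \<phi> x x 0))"
      using fg[of "s m x" n] mult_left_mono[OF \<phi>_s0[of m x x] \<open>0 \<le> K\<close>]
      by (intro mult_left_mono) auto
    finally show ?thesis by (simp add: mult_ac)
  qed
  have "\<exists>l. Y.conv (\<lambda>n. g n x) l" for x
    unfolding Y.conv_def
  proof (rule Y.complete)
    fix e :: real
    assume "0 < e"
    have "(\<lambda>n. K * (2 ^ n * (L / 8) ^ n * \<phi> x x 0)) \<longlonglongrightarrow> 0"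
      by (intro to_0) auto
    then have "\<forall>\<^sub>F n in sequentially. K * (2 ^ n * (L / 8) ^ n * \<phi> x x 0) < e / 2"
      using \<open>0 < e\<close> by (intro order_tendstoD(2)) auto
    then obtain M where M: "K * (2 ^ M * (L / 8) ^ M * \<phi> x x 0) < e / 2"
      unfolding eventually_sequentially by blast
    have "hnorm ipY (g M x - g n x) < e / 2" if "M \<le> n" for n
      using g_Cauchy[of M x "n - M"] M that by simp
    then have "hnorm ipY (g m x - g n x) < e" if "M \<le> m" "M \<le> n" for m n
      using that Y.hnorm_triangle_diff[of "g m x" "g n x" "g M x"]
        Y.hnorm_minus_commute[of "g m x" "g M x"] by (smt (verit) field_sum_of_halves)
    then show "\<exists>N. \<forall>m\<ge>N. \<forall>n\<ge>N. hnorm ipY (g m x - g n x) < e"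
      by blast
  qed
  then obtain H where H: "\<And>x. Y.conv (\<lambda>n. g n x) (H x)"
    by metis
  have fH: "hnorm ipY (f x - H x) \<le> K * \<phi> x x 0" for x
  proof (rule LIMSEQ_le_const)
    have "(\<lambda>n. K * \<phi> x x 0 + hnorm ipY (g n x - H x)) \<longlonglongrightarrow> K * \<phi> x x 0 + 0"
      using H[of x] unfolding Y.conv_def by (intro tendsto_intros)
    then show "(\<lambda>n. K * \<phi> x x 0 + hnorm ipY (g n x - H x)) \<longlonglongrightarrow> K * \<phi> x x 0"
      by simp
    show "\<exists>N. \<forall>n\<ge>N. hnorm ipY (f x - H x) \<le> K * \<phi> x x 0 + hnorm ipY (g n x - H x)"
      using fg[of x] Y.hnorm_triangle_diff[of "f x" "H x"] by (meson add_right_mono order_trans)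
  qed
  have H_lin: "H (sX \<mu> x + y) = sY \<mu> (H x) + H y" if "cmod \<mu> = 1" for \<mu> x y
  proof (rule Y.conv_eq_lim)
    show "Y.conv (\<lambda>n. g n (sX \<mu> x + y)) (H (sX \<mu> x + y))"
      by (rule H)
    show "Y.conv (\<lambda>n. sY \<mu> (g n x) + g n y) (sY \<mu> (H x) + H y)"
      by (intro Y.conv_add Y.conv_sX H)
    show "(\<lambda>n. hnorm ipY (g n (sX \<mu> x + y) - (sY \<mu> (g n x) + g n y))) \<longlonglongrightarrow> 0"
    proof (rule Y.hnorm_le_tendsto_0)
      fix n
      have "g n (sX \<mu> x + y) - (sY \<mu> (g n x) + g n y)
          = sY (2 ^ n) (f (sX \<mu> (s n x) + s n y) - sY \<mu> (f (s n x)) - f (s n y))"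
        by (simp add: g_def s_add s_sX Y.sX_diff Y.sX_sX mult.commute)
      then have "hnorm ipY (g n (sX \<mu> x + y) - (sY \<mu> (g n x) + g n y)) \<le> 2 ^ n * \<phi> (s n x) (s n y) 0"
        using f_lin[OF that] by (simp add: Y.hnorm_sX norm_power)
      also have "\<dots> \<le> 2 ^ n * ((L / 8) ^ n * \<phi> x y 0)"
        using \<phi>_s0 by (intro mult_left_mono) auto
      finally show "hnorm ipY (g n (sX \<mu> x + y) - (sY \<mu> (g n x) + g n y))
          \<le> 1 * (2 ^ n * (L / 8) ^ n * \<phi> x y 0)"
        by simp
    qed (intro to_0, auto)
  qed
  have H_add: "H (x + y) = H x + H y" for x y
    using H_lin[of 1 x y] by simp
  then have H_0: "H 0 = 0"
    by (metis add_cancel_right_left)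
  have H_unimodular: "H (sX \<mu> x) = sY \<mu> (H x)" if "cmod \<mu> = 1" for \<mu> x
    using H_lin[OF that, of x 0] by (simp add: H_0)
  have H_pow2: "H (sX (2 ^ n) x) = sY (2 ^ n) (H x)" for n x
  proof (induction n)
    case (Suc n)
    have "H (sX (2 ^ n + 2 ^ n) x) = sY (2 ^ n + 2 ^ n) (H x)"
      using Suc by (simp only: X.sX_add_left Y.sX_add_left H_add)
    then show ?case by simp
  qed simp
  have H_sX: "H (sX c x) = sY c (H x)" for c x
  proof -
    \<comment> \<open>Halving \<open>c\<close> often enough brings its modulus to at most 2, where
      it is a sum of two unimodular numbers.\<close>
    obtain n where n: "cmod c < 2 ^ n"
      using real_arch_pow[of 2 "cmod c"] by auto
    have "cmod c \<le> 2 * 2 ^ n"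
      using n norm_ge_zero[of c] by linarith
    then have "cmod (c / 2 ^ n) \<le> 2"
      by (simp add: norm_divide norm_power field_simps)
    then obtain \<mu> \<nu> where u: "cmod \<mu> = 1" "cmod \<nu> = 1" and "c / 2 ^ n = \<mu> + \<nu>"
      by (rule sum_of_two_unimodular)
    then have c: "c = 2 ^ n * (\<mu> + \<nu>)"
      by (simp add: field_simps)
    have "H (sX (2 ^ n) (sX \<mu> x + sX \<nu> x)) = sY (2 ^ n) (sY \<mu> (H x) + sY \<nu> (H x))"
      using u by (simp only: H_pow2 H_add H_unimodular)
    then show ?thesis
      by (simp only: c X.sX_sX[symmetric] Y.sX_sX[symmetric] X.sX_add_left Y.sX_add_left)
  qed
  have H_hom: "H (actX (ipX x y) z) = actY (ipY (H x) (H y)) (H z)" for x y z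
  proof (rule Y.conv_eq_lim)
    let ?w = "actX (ipX x y) z"
    \<comment> \<open>Scaling all three arguments by \<open>2 ^ n\<close> scales the triple product
      by \<open>2 ^ (3 * n)\<close>, so the left side is taken along the subsequence of multiples of
      3.\<close>
    have "filterlim (\<lambda>n::nat. n * 3) sequentially sequentially"
      by (rule mult_nat_right_at_top) simp
    with H[of ?w] show "Y.conv (\<lambda>n. g (n * 3) ?w) (H ?w)"
      unfolding Y.conv_def by (rule filterlim_compose)
    show "Y.conv (\<lambda>n. actY (ipY (g n x) (g n y)) (g n z)) (actY (ipY (H x) (H y)) (H z))"
      by (intro Y.conv_act Y.conv_ip H)
    show "(\<lambda>n. hnorm ipY (g (n * 3) ?w - actY (ipY (g n x) (g n y)) (g n z))) \<longlonglongrightarrow> 0"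
    proof (rule Y.hnorm_le_tendsto_0)
      fix n
      let ?D = "f (actX (ipX (s n x) (s n y)) (s n z)) - actY (ipY (f (s n x)) (f (s n y))) (f (s n z))"
      have "s (n * 3) ?w = actX (ipX (s n x) (s n y)) (s n z)"
        by (simp add: s_def X.ip_sX_left X.ip_sX_right X.act_sc X.act_sX X.sX_sX power_mult
            power3_eq_cube mult.assoc)
      then have "g (n * 3) ?w - actY (ipY (g n x) (g n y)) (g n z) = sY (2 ^ (n * 3)) ?D"
        by (simp add: g_def Y.ip_sX_left Y.ip_sX_right Y.act_sc Y.act_sX Y.sX_sX Y.sX_diff power_mult
            power3_eq_cube mult.assoc)
      then have "hnorm ipY (g (n * 3) ?w - actY (ipY (g n x) (g n y)) (g n z)) = 2 ^ (n * 3) * hnorm ipY ?D"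
        by (simp add: Y.hnorm_sX norm_power)
      also have "\<dots> \<le> 2 ^ (n * 3) * ((L / 8) ^ n * \<phi> x y z)"
        by (intro mult_left_mono order_trans[OF f_hom \<phi>_s]) auto
      also have "(2::real) ^ (n * 3) = 8 ^ n"
        by (simp add: mult.commute[of n] power_mult)
      finally show "hnorm ipY (g (n * 3) ?w - actY (ipY (g n x) (g n y)) (g n z))
          \<le> 1 * (8 ^ n * (L / 8) ^ n * \<phi> x y z)"
        by simp
    qed (intro to_0, auto)
  qed
  show ?thesis
  proof (rule ex1I)
    show "hm_star_hom stA stB sX actX ipX sY actY ipY H \<and>
        (\<forall>x. hnorm ipY (f x - H x) \<le> L / (8 - 8 * L) * \<phi> x x 0)"
      using fH unfolding hm_star_hom_def hm_hom_def K_def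
      by (simp add: H_add H_sX H_hom X.st_ip Y.st_ip)
  next
    fix G
    assume G: "hm_star_hom stA stB sX actX ipX sY actY ipY G \<and>
        (\<forall>x. hnorm ipY (f x - G x) \<le> L / (8 - 8 * L) * \<phi> x x 0)"
    then have G_sX: "G (sX c x) = sY c (G x)" and fG: "hnorm ipY (f x - G x) \<le> K * \<phi> x x 0" for c x
      unfolding hm_star_hom_def hm_hom_def K_def by blast+
    show "G = H"
    proof
      fix x
      \<comment> \<open>By homogeneity \<open>G x\<close> is \<open>2 ^ n\<close> times
        \<open>G (s n x)\<close>, so the bound for \<open>G\<close> at \<open>s n x\<close> makes
        \<open>g n x\<close> converge to \<open>G x\<close> too.\<close>
      have G_conv: "Y.conv (\<lambda>n. g n x) (G x)"
        unfolding Y.conv_def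
      proof (rule Y.hnorm_le_tendsto_0)
        fix n
        have "G x = sY (2 ^ n) (G (s n x))"
          by (simp add: s_def G_sX Y.sX_sX)
        then have "hnorm ipY (g n x - G x) = 2 ^ n * hnorm ipY (f (s n x) - G (s n x))"
          by (simp add: g_def Y.hnorm_sX norm_power flip: Y.sX_diff)
        also have "\<dots> \<le> 2 ^ n * (K * ((L / 8) ^ n * \<phi> x x 0))"
          using fG[of "s n x"] mult_left_mono[OF \<phi>_s0[of n x x] \<open>0 \<le> K\<close>]
          by (intro mult_left_mono) auto
        finally show "hnorm ipY (g n x - G x) \<le> K * (2 ^ n * (L / 8) ^ n * \<phi> x x 0)"
          by (simp add: mult_ac)
      qed (intro to_0, auto)
      show "G x = H x"
        by (rule Y.conv_eq_lim[OF G_conv H]) simp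
    qed
  qed
qed

end
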